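(* Let $F$ be a field, $E/F$ a quadratic field extension with nontrivial automorphism $\sigma$, and let $A=E\oplus E$ be the four-dimensional $F$-algebra with multiplication $$(a,b)(c,d)=(ac+b^{\sigma}d,\; bc+a^{\sigma}d+b^{\sigma}d^{\sigma}).$$ Let $x,y,x',y'\in A$, and assume that the right multiplications $R_x,R_y,R_{x'},R_{y'}$ are invertible. Write $x=(a,b)$, $y=(c,d)$, $x'=(a',b')$, $y'=(c',d')$ with $a,b,c,d,a',b',c',d'\in E$. Then $A(x,y)=A(x',y')$ if and only if one of the following holds: (i) $x'=tx$, $y'=ty$ for some $t\in F^{\times}$. (ii) $x=my$, $x'=my'$ for some $m\in F^{\times}$. (iii) $b=d=0$, $b'=d'=0$, and $a'=ta$, $c'=tc$ for some $t\in E^{\times}$. (iv) There exist $l,m,t\in E^{\times}$ such that $$a^{\sigma}=lb,\quad b^{\sigma}=la,\quad a'^{\sigma}=lb',\quad b'^{\sigma}=la',$$ $$c^{\sigma}=md,\quad d^{\sigma}=mc,\quad c'^{\sigma}=md',\quad d'^{\sigma}=mc',$$ $$c=ta,\quad d=tb,\quad c'=ta',\quad d'=tb'.$$ (These equations imply $lt^{\sigma}=mt$.)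
   Context: The base field $F$ has arbitrary characteristic. An algebra is an $F$-vector space with bilinear, not necessarily associative, multiplication. For an element $z$ of an algebra $A$, $R_z\colon A\to A$ is the $F$-linear map $R_z(u)=uz$. The algebra $A$ acts on $A^2=A\oplus A$ by $a(x,y)=(ax,ay)$, and $A(x,y)=\{(ax,ay)\mid a\in A\}\subset A^2$. *)

theory Defs
  imports Complex_Main "HOL-Library.Product_Plus"
begin

(* The extension E/F is an embedding emb of a field type 'f into a field type 'e.
   vector_space.dim is 0 for infinite-dimensional spaces, so dim = 2 includes
   finite-dimensionality. *)

definition scaleE :: "('f::field \<Rightarrow> 'e::field) \<Rightarrow> 'f \<Rightarrow> 'e \<Rightarrow> 'e"
  where "scaleE emb k u = emb k * u"

locale field_extension =
  fixes emb :: "'f::field \<Rightarrow> 'e::field"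
  assumes emb_add: "emb (k + l) = emb k + emb l"
    and emb_mult: "emb (k * l) = emb k * emb l"
    and emb_one: "emb 1 = 1"

locale quadratic_extension = field_extension emb
  for emb :: "'f::field \<Rightarrow> 'e::field" +
  assumes degree_two: "vector_space.dim (scaleE emb) (UNIV :: 'e set) = 2"

locale extension_automorphism = field_extension emb
  for emb :: "'f::field \<Rightarrow> 'e::field" and \<sigma> :: "'e \<Rightarrow> 'e" +
  assumes aut_bij: "bij \<sigma>"
    and aut_add: "\<sigma> (u + v) = \<sigma> u + \<sigma> v"
    and aut_mult: "\<sigma> (u * v) = \<sigma> u * \<sigma> v"
    and aut_fixes: "\<sigma> (emb k) = emb k"

definition scaleA :: "('f::field \<Rightarrow> 'e::field) \<Rightarrow> 'f \<Rightarrow> 'e \<times> 'e \<Rightarrow> 'e \<times> 'e"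
  where "scaleA emb k x = (emb k * fst x, emb k * snd x)"

fun multA :: "('e::field \<Rightarrow> 'e) \<Rightarrow> 'e \<times> 'e \<Rightarrow> 'e \<times> 'e \<Rightarrow> 'e \<times> 'e"
  where "multA \<sigma> (a, b) (c, d) = (a * c + \<sigma> b * d, b * c + \<sigma> a * d + \<sigma> b * \<sigma> d)"

definition right_mult :: "('e::field \<Rightarrow> 'e) \<Rightarrow> 'e \<times> 'e \<Rightarrow> 'e \<times> 'e \<Rightarrow> 'e \<times> 'e"
  where "right_mult \<sigma> z u = multA \<sigma> u z"

(* Invertible in the algebra of F-linear endomorphisms of A. *)
definition invertible_on_A ::
    "('f::field \<Rightarrow> 'e::field) \<Rightarrow> ('e \<times> 'e \<Rightarrow> 'e \<times> 'e) \<Rightarrow> bool"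
  where "invertible_on_A emb f \<longleftrightarrow>
    Vector_Spaces.linear (scaleA emb) (scaleA emb) f \<and>
    (\<exists>g. Vector_Spaces.linear (scaleA emb) (scaleA emb) g \<and> g \<circ> f = id \<and> f \<circ> g = id)"

definition orbitA ::
    "('e::field \<Rightarrow> 'e) \<Rightarrow> 'e \<times> 'e \<Rightarrow> 'e \<times> 'e \<Rightarrow> (('e \<times> 'e) \<times> ('e \<times> 'e)) set"
  where "orbitA \<sigma> x y = {(multA \<sigma> a x, multA \<sigma> a y) | a. True}"

(* A is an F-algebra: scaleA is a vector space structure and multA is bilinear;
   in particular the linearity clause for right_mult in invertible_on_A is automatic. *)

lemma (in field_extension) vector_space_scaleE: "vector_space (scaleE emb)"
  by unfold_locales (simp_all add: scaleE_def emb_add emb_mult emb_one algebra_simps)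

lemma (in field_extension) vector_space_scaleA: "vector_space (scaleA emb)"
  by unfold_locales (simp_all add: scaleA_def emb_add emb_mult emb_one algebra_simps)

lemma (in extension_automorphism) linear_right_mult:
  "Vector_Spaces.linear (scaleA emb) (scaleA emb) (right_mult \<sigma> z)"
  using vector_space_scaleA
  by (cases z) (auto simp: Vector_Spaces.linear_def module_hom_def module_hom_axioms_def
      vector_space_def module_def right_mult_def scaleA_def aut_add aut_mult aut_fixes algebra_simps)

lemma (in extension_automorphism) linear_left_mult:
  "Vector_Spaces.linear (scaleA emb) (scaleA emb) (multA \<sigma> z)"
  using vector_space_scaleA
  by (cases z) (auto simp: Vector_Spaces.linear_def module_hom_def module_hom_axioms_def
      vector_space_def module_def scaleA_def aut_add aut_mult aut_fixes algebra_simps)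

end

theory Submission
  imports Defs
begin

text \<open>
  Write \<open>R\<^sub>z\<close> for right multiplication by \<open>z\<close>. Since \<open>R\<^sub>x\<close> is invertible, the
  subspace \<open>A(x, y)\<close> is the graph of the operator \<open>T = R\<^sub>y R\<^sub>x\<inverse>\<close>. Hence
  \<open>A(x, y) = A(x', y')\<close> means that one \<open>F\<close>-linear \<open>T\<close> satisfies both
  \<open>T R\<^sub>x = R\<^sub>y\<close> and \<open>T R\<^sub>x\<^sub>' = R\<^sub>y\<^sub>'\<close> (lemmas \<open>orbit_operator\<close> and
  \<open>orbit_eq_by_operator\<close>).

  Every \<open>F\<close>-linear endomorphism of \<open>E\<close> has the form \<open>k + l\<sigma>\<close> with unique
  \<open>k, l\<close> in \<open>E\<close>. So \<open>T\<close> is a two-by-two matrix of such expressions, with eight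
  coefficients, and \<open>T R\<^sub>x = R\<^sub>y\<close> becomes eight equations (the predicate
  \<open>intertwines\<close>). For fixed \<open>T\<close> they cut out an \<open>F\<close>-subspace of pairs \<open>(x, y)\<close>,
  in which \<open>y\<close> is determined by \<open>x\<close>.
  If \<open>x\<close> and \<open>x'\<close> are \<open>F\<close>-proportional, this is relation (i). If they are not,
  the two systems together leave very little room for \<open>T\<close>: its first row is
  \<open>(t, 0)\<close> with \<open>t\<close> in \<open>E\<close>, so \<open>y = tx\<close> and \<open>y' = tx'\<close> componentwise.
  The second row then forces one of three things: \<open>t\<close> lies in \<open>F\<close>, which is (ii);
  the second coordinates of \<open>x\<close> and \<open>x'\<close> vanish, which is (iii); or the two
  coordinates of \<open>x\<close> have equal norms, likewise those of \<open>x'\<close>, and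
  \<open>\<sigma> a / b = \<sigma> a' / b'\<close>, which is (iv) with this quotient as \<open>l\<close>. This is lemma
  \<open>intertwines_classification\<close>; its main case is \<open>intertwines_full_support\<close>.

  Conversely, in each of the four relations there is an operator \<open>T\<close>, expressible
  through \<open>t\<close>, \<open>l\<close>, \<open>m\<close> alone in the last three, that serves both pairs.
\<close>

locale conjugation_extension =
  quadratic_extension emb + extension_automorphism emb \<sigma>
  for emb :: "'f::field \<Rightarrow> 'e::field" and \<sigma> :: "'e \<Rightarrow> 'e" +
  assumes nontrivial: "\<sigma> \<noteq> id"
begin

section \<open>Conjugation on a quadratic extension\<close>

lemma emb_zero [simp]: "emb 0 = 0"
  using emb_add[of 0 0] by (simp only: add_0_right add_cancel_right_right)

lemma emb_eq_zero_iff [simp]: "emb k = 0 \<longleftrightarrow> k = 0"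
proof
  assume "emb k = 0"
  then show "k = 0"
    using emb_mult[of k "inverse k"] emb_one by (cases "k = 0") auto
qed simp

lemma conj_zero [simp]: "\<sigma> 0 = 0"
  using aut_add[of 0 0] by (simp only: add_0_right add_cancel_right_right)

lemma conj_eq_zero_iff [simp]: "\<sigma> u = 0 \<longleftrightarrow> u = 0"
  using aut_bij conj_zero by (metis bij_pointE)

lemma conj_one [simp]: "\<sigma> 1 = 1"
  using aut_fixes[of 1] by (simp add: emb_one)

lemma conj_minus [simp]: "\<sigma> (- u) = - \<sigma> u"
  using aut_add[of u "- u"] by (simp add: eq_neg_iff_add_eq_0 add.commute)

lemma conj_diff: "\<sigma> (u - v) = \<sigma> u - \<sigma> v"
  using aut_add[of u "- v"] by simp

lemma conj_divide: "\<sigma> (u / v) = \<sigma> u / \<sigma> v"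
  using aut_mult[of "u / v" v] by (cases "v = 0") (auto simp: field_simps)

text \<open>
  An element moved by \<open>\<sigma>\<close> lies outside \<open>F\<close>, so together with \<open>1\<close> it is a basis of
  the two-dimensional space \<open>E\<close>. All further facts about \<open>\<sigma>\<close> are read off from
  coordinates in such a basis.
\<close>

lemma moved_element_generates:
  assumes "\<sigma> w \<noteq> w"
  obtains k l where "u = emb k + emb l * w"
proof -
  interpret E: vector_space "scaleE emb" by (rule vector_space_scaleE)
  obtain B where B: "E.independent B" "UNIV \<subseteq> E.span B" "card B = E.dim (UNIV :: 'e set)"
    using E.basis_exists[of UNIV] by blast
  have card: "card B = 2" using B(3) degree_two by simp
  have fin: "finite B" using card by (auto intro: card_ge_0_finite)
  have w: "w \<notin> E.span {1}"
    using assms aut_fixes by (auto simp: E.span_singleton scaleE_def)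
  then have ne: "w \<noteq> 1" using E.span_base[of 1 "{1}"] by auto
  have "E.independent {w, 1}"
    using w E.independent_insert[of w "{1}"] by simp
  have "u \<in> E.span {w, 1}"
  proof (rule ccontr)
    assume u: "u \<notin> E.span {w, 1}"
    then have "u \<noteq> w" "u \<noteq> 1"
      using E.span_base[of w "{w, 1}"] E.span_base[of 1 "{w, 1}"] by auto
    moreover have "E.independent {u, w, 1}"
      using u \<open>E.independent {w, 1}\<close> by (rule E.independent_insertI)
    then have "card {u, w, 1} \<le> card B"
      using E.independent_span_bound[OF fin _ subset_trans[OF subset_UNIV B(2)]] by blast
    ultimately show False using ne card by simp
  qed
  then obtain l where "u - emb l * w \<in> E.span {1}"
    by (auto simp: E.span_insert[of w] scaleE_def)
  then obtain k where "u - emb l * w = emb k"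
    by (auto simp: E.span_singleton scaleE_def)
  then show thesis using that by (metis diff_add_cancel)
qed

lemma moved_element:
  obtains w where "\<sigma> w \<noteq> w"
  using nontrivial by (auto simp: fun_eq_iff)

text \<open>
  Both \<open>w\<close> and \<open>\<sigma> w\<close> are roots of the same monic quadratic polynomial over \<open>F\<close>.
  They are distinct, so their sum is its linear coefficient up to sign and lies in
  \<open>F\<close>; hence \<open>\<sigma>\<close> exchanges them.
\<close>

lemma conj_conj [simp]: "\<sigma> (\<sigma> u) = u"
proof -
  obtain w where w: "\<sigma> w \<noteq> w" by (rule moved_element)
  obtain p q where sq: "w * w = emb p + emb q * w"
    using moved_element_generates[OF w] .
  then have "\<sigma> w * \<sigma> w = emb p + emb q * \<sigma> w"
    by (metis aut_add aut_fixes aut_mult)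
  with sq have "(\<sigma> w - w) * (\<sigma> w + w - emb q) = 0" by algebra
  then have trace: "\<sigma> w = emb q - w" using w by algebra
  then have "\<sigma> (\<sigma> w) = w" by (metis aut_fixes conj_diff diff_diff_eq2 add_diff_cancel_left')
  moreover obtain k l where "u = emb k + emb l * w"
    using moved_element_generates[OF w] .
  ultimately show ?thesis by (simp add: aut_add aut_mult aut_fixes)
qed

lemma fixed_by_conj:
  assumes "\<sigma> u = u"
  obtains k where "u = emb k"
proof -
  obtain w where w: "\<sigma> w \<noteq> w" by (rule moved_element)
  obtain k l where u: "u = emb k + emb l * w"
    using moved_element_generates[OF w] .
  then have "emb l * (\<sigma> w - w) = 0"
    using assms by (simp add: aut_add aut_mult aut_fixes algebra_simps)
  then have "u = emb k" using u w by simp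
  then show thesis by (rule that)
qed

text \<open>
  The independence of \<open>id\<close> and \<open>\<sigma>\<close> over \<open>E\<close>; it is what permits comparing
  coefficients below.
\<close>

lemma linear_combination_unique:
  assumes "\<And>u. k * u + l * \<sigma> u = k' * u + l' * \<sigma> u"
  shows "k = k' \<and> l = l'"
proof -
  obtain w where w: "\<sigma> w \<noteq> w" by (rule moved_element)
  have 1: "k + l = k' + l'" using assms[of 1] by simp
  have "(l - l') * (\<sigma> w - w) = 0" using assms[of w] 1 by algebra
  then show ?thesis using w 1 by simp
qed

text \<open>
  The \<open>F\<close>-endomorphisms of \<open>E\<close> form the twisted group ring \<open>E + E\<sigma>\<close>: the two
  coefficients solve the linear system given by the values at \<open>1\<close> and at a moved
  element \<open>w\<close>, whose determinant is \<open>\<sigma> w - w\<close>.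
\<close>

lemma linear_map_E:
  assumes add: "\<And>u v. f (u + v) = f u + f v"
    and scale: "\<And>k u. f (emb k * u) = emb k * f u"
  obtains k l where "\<And>u. f u = k * u + l * \<sigma> u"
proof -
  obtain w where w: "\<sigma> w \<noteq> w" by (rule moved_element)
  define l where "l = (f w - w * f 1) / (\<sigma> w - w)"
  have l: "l * (\<sigma> w - w) = f w - w * f 1" using w by (simp add: l_def)
  have "f u = (f 1 - l) * u + l * \<sigma> u" for u
  proof -
    obtain p q where u: "u = emb p + emb q * w"
      using moved_element_generates[OF w] .
    have "f u = emb p * f 1 + emb q * f w"
      using u add[of "emb p" "emb q * w"] scale[of p 1] scale[of q w] by simp
    moreover have "\<sigma> u = emb p + emb q * \<sigma> w"
      using u by (simp add: aut_add aut_mult aut_fixes)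
    ultimately show ?thesis using l u by algebra
  qed
  then show thesis by (rule that)
qed

section \<open>The operator determined by an orbit\<close>

lemma linear_iff_A:
  "Vector_Spaces.linear (scaleA emb) (scaleA emb) f \<longleftrightarrow>
    (\<forall>u v. f (u + v) = f u + f v) \<and> (\<forall>k u. f (scaleA emb k u) = scaleA emb k (f u))"
  using vector_space_scaleA
  by (auto simp: Vector_Spaces.linear_def module_hom_def module_hom_axioms_def
      vector_space_def module_def)

lemma linear_map_A:
  assumes "Vector_Spaces.linear (scaleA emb) (scaleA emb) T"
  obtains k1 k2 k3 k4 m1 m2 m3 m4 where
    "\<And>u v. T (u, v) = (k1 * u + k2 * \<sigma> u + k3 * v + k4 * \<sigma> v,
                    m1 * u + m2 * \<sigma> u + m3 * v + m4 * \<sigma> v)"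
proof -
  have add: "T (u + v) = T u + T v" and scale: "T (scaleA emb k u) = scaleA emb k (T u)"
    for u v k using assms unfolding linear_iff_A by blast+
  have sum1: "T (u + v, 0) = T (u, 0) + T (v, 0)"
    and sum2: "T (0, u + v) = T (0, u) + T (0, v)"
    and scale1: "T (emb k * u, 0) = scaleA emb k (T (u, 0))"
    and scale2: "T (0, emb k * u) = scaleA emb k (T (0, u))" for u v k
    using add[of "(u, 0)" "(v, 0)"] add[of "(0, u)" "(0, v)"]
      scale[of k "(u, 0)"] scale[of k "(0, u)"] by (simp_all add: scaleA_def)
  obtain k1 k2 where 1: "\<And>u. fst (T (u, 0)) = k1 * u + k2 * \<sigma> u"
    by (rule linear_map_E[of "\<lambda>u. fst (T (u, 0))"]) (auto simp: sum1 scale1 scaleA_def)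
  obtain m1 m2 where 2: "\<And>u. snd (T (u, 0)) = m1 * u + m2 * \<sigma> u"
    by (rule linear_map_E[of "\<lambda>u. snd (T (u, 0))"]) (auto simp: sum1 scale1 scaleA_def)
  obtain k3 k4 where 3: "\<And>u. fst (T (0, u)) = k3 * u + k4 * \<sigma> u"
    by (rule linear_map_E[of "\<lambda>u. fst (T (0, u))"]) (auto simp: sum2 scale2 scaleA_def)
  obtain m3 m4 where 4: "\<And>u. snd (T (0, u)) = m3 * u + m4 * \<sigma> u"
    by (rule linear_map_E[of "\<lambda>u. snd (T (0, u))"]) (auto simp: sum2 scale2 scaleA_def)
  show thesis
  proof (rule that[of k1 k2 k3 k4 m1 m2 m3 m4])
    fix u v
    show "T (u, v) = (k1 * u + k2 * \<sigma> u + k3 * v + k4 * \<sigma> v,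
                    m1 * u + m2 * \<sigma> u + m3 * v + m4 * \<sigma> v)"
      using add[of "(u, 0)" "(0, v)"] 1 2 3 4 by (simp add: prod_eq_iff algebra_simps)
  qed
qed

lemma invertible_bij:
  assumes "invertible_on_A emb f"
  shows "bij f"
  using assms unfolding invertible_on_A_def by (metis o_bij)

lemma invertible_nonzero:
  assumes "invertible_on_A emb (right_mult \<sigma> (a, b))"
  shows "a \<noteq> 0 \<or> b \<noteq> 0"
proof (rule ccontr)
  assume "\<not> (a \<noteq> 0 \<or> b \<noteq> 0)"
  then have "right_mult \<sigma> (a, b) (1, 0) = right_mult \<sigma> (a, b) (0, 0)"
    by (simp add: right_mult_def)
  then show False using bij_is_inj[OF invertible_bij[OF assms]] by (auto dest!: injD)
qed

lemma orbitA_range: "orbitA \<sigma> x y = range (\<lambda>u. (multA \<sigma> u x, multA \<sigma> u y))"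
  unfolding orbitA_def by (rule set_eqI) (simp add: image_iff del: split_paired_Ex)

text \<open>
  The operator is \<open>R\<^sub>y R\<^sub>x\<inverse>\<close>, and it also carries \<open>R\<^sub>x\<^sub>'\<close> to \<open>R\<^sub>y\<^sub>'\<close> because each
  \<open>(ux', uy')\<close> equals some \<open>(wx, wy)\<close>.
\<close>

lemma orbit_operator:
  assumes inv: "invertible_on_A emb (right_mult \<sigma> x)"
    and eq: "orbitA \<sigma> x y = orbitA \<sigma> x' y'"
  obtains T where "Vector_Spaces.linear (scaleA emb) (scaleA emb) T"
    "\<And>u. T (multA \<sigma> u x) = multA \<sigma> u y" "\<And>u. T (multA \<sigma> u x') = multA \<sigma> u y'"
proof -
  obtain g where g: "Vector_Spaces.linear (scaleA emb) (scaleA emb) g"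
    and gx: "g \<circ> right_mult \<sigma> x = id"
    using inv unfolding invertible_on_A_def by blast
  let ?T = "right_mult \<sigma> y \<circ> g"
  have lin: "Vector_Spaces.linear (scaleA emb) (scaleA emb) ?T"
    using g linear_right_mult[of y] unfolding linear_iff_A
    by (simp del: split_paired_All)
  have 1: "?T (multA \<sigma> u x) = multA \<sigma> u y" for u
    using fun_cong[OF gx, of u] by (simp add: right_mult_def)
  have 2: "?T (multA \<sigma> u x') = multA \<sigma> u y'" for u
  proof -
    have "(multA \<sigma> u x', multA \<sigma> u y') \<in> range (\<lambda>w. (multA \<sigma> w x, multA \<sigma> w y))"
      by (rule rangeI[of "\<lambda>w. (multA \<sigma> w x', multA \<sigma> w y')", folded eq[unfolded orbitA_range]])
    then obtain w where "(multA \<sigma> u x', multA \<sigma> u y') = (multA \<sigma> w x, multA \<sigma> w y)"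
      by (rule rangeE)
    then show ?thesis using 1[of w] by simp
  qed
  show thesis by (rule that[OF lin 1 2])
qed

lemma orbit_eq_graph:
  assumes inv: "invertible_on_A emb (right_mult \<sigma> x)"
    and T: "\<And>u. T (multA \<sigma> u x) = multA \<sigma> u y"
  shows "orbitA \<sigma> x y = range (\<lambda>v. (v, T v))"
proof -
  have "orbitA \<sigma> x y = (\<lambda>v. (v, T v)) ` range (right_mult \<sigma> x)"
    by (simp add: orbitA_range image_image right_mult_def T)
  then show ?thesis
    using bij_is_surj[OF invertible_bij[OF inv]] by simp
qed

section \<open>Comparing coefficients\<close>

text \<open>
  Reading \<open>(k1, k2)\<close>, \<open>(k3, k4)\<close>, \<open>(m1, m2)\<close>, \<open>(m3, m4)\<close> as the entries
  \<open>k1 + k2 \<sigma>\<close>, and so on, of a matrix \<open>T\<close>, these are the coefficients of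
  \<open>p\<close>, \<open>\<sigma> p\<close>, \<open>q\<close>, \<open>\<sigma> q\<close> in the two coordinates of
  \<open>T ((p, q) (a, b)) = (p, q) (c, d)\<close>.
\<close>

definition intertwines ::
    "'e \<Rightarrow> 'e \<Rightarrow> 'e \<Rightarrow> 'e \<Rightarrow> 'e \<Rightarrow> 'e \<Rightarrow> 'e \<Rightarrow> 'e \<Rightarrow> 'e \<Rightarrow> 'e \<Rightarrow> 'e \<Rightarrow> 'e \<Rightarrow> bool"
  where "intertwines k1 k2 k3 k4 m1 m2 m3 m4 a b c d \<longleftrightarrow>
    k1 * a + k4 * \<sigma> b = c \<and> k2 * \<sigma> a + k3 * b = 0 \<and>
    k2 * \<sigma> b + k3 * a + k4 * b = 0 \<and> k1 * b + k4 * \<sigma> a + k3 * \<sigma> b = d \<and>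
    m1 * a + m4 * \<sigma> b = 0 \<and> m2 * \<sigma> a + m3 * b = d \<and>
    m2 * \<sigma> b + m3 * a + m4 * b = c \<and> m1 * b + m4 * \<sigma> a + m3 * \<sigma> b = \<sigma> d"

lemma intertwinesD:
  assumes "intertwines k1 k2 k3 k4 m1 m2 m3 m4 a b c d"
  shows "k1 * a + k4 * \<sigma> b = c" "k2 * \<sigma> a + k3 * b = 0"
    "k2 * \<sigma> b + k3 * a + k4 * b = 0" "k1 * b + k4 * \<sigma> a + k3 * \<sigma> b = d"
    "m1 * a + m4 * \<sigma> b = 0" "m2 * \<sigma> a + m3 * b = d"
    "m2 * \<sigma> b + m3 * a + m4 * b = c" "m1 * b + m4 * \<sigma> a + m3 * \<sigma> b = \<sigma> d"
  using assms unfolding intertwines_def by blast+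

lemma intertwines_if_operator:
  assumes T: "\<And>u v. T (u, v) = (k1 * u + k2 * \<sigma> u + k3 * v + k4 * \<sigma> v,
                    m1 * u + m2 * \<sigma> u + m3 * v + m4 * \<sigma> v)"
    and eq: "\<And>u. T (multA \<sigma> u (a, b)) = multA \<sigma> u (c, d)"
  shows "intertwines k1 k2 k3 k4 m1 m2 m3 m4 a b c d"
proof -
  have "(k1 * a + k4 * \<sigma> b) * u + (k2 * \<sigma> a + k3 * b) * \<sigma> u = c * u + 0 * \<sigma> u"
    and "(m1 * a + m4 * \<sigma> b) * u + (m2 * \<sigma> a + m3 * b) * \<sigma> u = 0 * u + d * \<sigma> u" for u
    using eq[of "(u, 0)"] by (auto simp: T aut_mult algebra_simps)
  note 1 = this[THEN linear_combination_unique]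
  have "(k2 * \<sigma> b + k3 * a + k4 * b) * u + (k1 * b + k4 * \<sigma> a + k3 * \<sigma> b) * \<sigma> u = 0 * u + d * \<sigma> u"
    and "(m2 * \<sigma> b + m3 * a + m4 * b) * u + (m1 * b + m4 * \<sigma> a + m3 * \<sigma> b) * \<sigma> u = c * u + \<sigma> d * \<sigma> u" for u
    using eq[of "(0, u)"] by (auto simp: T aut_mult aut_add algebra_simps)
  note 2 = this[THEN linear_combination_unique]
  show ?thesis unfolding intertwines_def using 1 2 by simp
qed

text \<open>
  The ratio ranges over the nonzero elements fixed by \<open>\<sigma>\<close>, that is, over
  \<open>F\<^sup>\<times>\<close> by \<open>fixed_by_conj\<close>; staying inside \<open>E\<close> avoids coercions in the algebra.
\<close>

definition proportional :: "'e \<Rightarrow> 'e \<Rightarrow> 'e \<Rightarrow> 'e \<Rightarrow> bool"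
  where "proportional a b a' b' \<longleftrightarrow> (\<exists>s. \<sigma> s = s \<and> s \<noteq> 0 \<and> a' = s * a \<and> b' = s * b)"

lemma proportional_sym: "proportional a b a' b' \<Longrightarrow> proportional a' b' a b"
  unfolding proportional_def
proof (elim exE conjE)
  fix s assume "\<sigma> s = s" "s \<noteq> 0" "a' = s * a" "b' = s * b"
  then show "\<exists>s. \<sigma> s = s \<and> s \<noteq> 0 \<and> a = s * a' \<and> b = s * b'"
    by (intro exI[of _ "1 / s"]) (simp add: conj_divide)
qed

lemma intertwines_proportional:
  assumes "intertwines k1 k2 k3 k4 m1 m2 m3 m4 a b c d"
    and "intertwines k1 k2 k3 k4 m1 m2 m3 m4 a' b' c' d'"
    and "\<sigma> s = s" "a' = s * a" "b' = s * b"
  shows "c' = s * c \<and> d' = s * d"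
  using assms unfolding intertwines_def by (auto simp: aut_mult algebra_simps)

definition common_multiplier :: "'e \<Rightarrow> 'e \<Rightarrow> 'e \<Rightarrow> 'e \<Rightarrow> 'e \<Rightarrow> 'e \<Rightarrow> 'e \<Rightarrow> 'e \<Rightarrow> 'e \<Rightarrow> bool"
  where "common_multiplier t a b c d a' b' c' d' \<longleftrightarrow>
    c = t * a \<and> d = t * b \<and> c' = t * a' \<and> d' = t * b'"

text \<open>
  An equation that prescribes \<open>u / \<sigma> u\<close> determines \<open>u\<close> up to a factor in \<open>F\<close>.
  In the degenerate cases below this is how proportionality arises.
\<close>

lemma ratio_fixed:
  assumes "u \<noteq> 0" "\<sigma> u * v = u * \<sigma> v"
  shows "\<sigma> (v / u) = v / u"
  using assms by (simp add: conj_divide field_simps)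

text \<open>
  With \<open>b = 0\<close> the first system leaves only \<open>k1\<close> and \<open>k4\<close> free. A nonzero \<open>k4\<close>
  makes \<open>b'\<close> vanish and prescribes \<open>a' / \<sigma> a'\<close>; if \<open>k4 = 0\<close>, then \<open>T\<close> is
  multiplication by \<open>k1\<close> in both coordinates, and a nonzero \<open>b'\<close> puts \<open>k1\<close> in \<open>F\<close>.
\<close>

lemma intertwines_first_only:
  assumes I: "intertwines k1 k2 k3 k4 m1 m2 m3 m4 a 0 c d"
    and I': "intertwines k1 k2 k3 k4 m1 m2 m3 m4 a' b' c' d'"
    and nz: "a \<noteq> 0" "a' \<noteq> 0 \<or> b' \<noteq> 0"
  shows "proportional a 0 a' b' \<or>
    (\<exists>t. common_multiplier t a 0 c d a' b' c' d' \<and> (\<sigma> t = t \<or> b' = 0))"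
proof -
  have k: "k2 = 0" "k3 = 0" "m1 = 0" "m3 = k1" "m2 = k4"
    and c: "c = k1 * a" and d: "d = k4 * \<sigma> a" and m4: "m4 * \<sigma> a = \<sigma> k4 * a"
    using I nz by (auto simp: intertwines_def aut_mult)
  show ?thesis
  proof (cases "k4 = 0")
    case True
    then have "m4 = 0" using m4 nz by simp
    then have "common_multiplier k1 a 0 c d a' b' c' d'" and "\<sigma> k1 * \<sigma> b' = k1 * \<sigma> b'"
      using I I' k True by (auto simp: intertwines_def common_multiplier_def aut_mult)
    then show ?thesis by auto
  next
    case False
    then have b': "b' = 0" using I' k by (simp add: intertwines_def)
    then have "m4 * \<sigma> a' = \<sigma> k4 * a'" using I' k by (auto simp: intertwines_def aut_mult)
    then have "\<sigma> k4 * (\<sigma> a * a') = \<sigma> k4 * (a * \<sigma> a')" using m4 by algebra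
    then have "\<sigma> (a' / a) = a' / a" using False nz by (intro ratio_fixed) auto
    then have "proportional a 0 a' b'"
      unfolding proportional_def using b' nz by (intro exI[of _ "a' / a"]) auto
    then show ?thesis ..
  qed
qed

text \<open>
  If \<open>T\<close> is not multiplication by an element of \<open>F\<close>, one of \<open>k4\<close>, \<open>m1\<close> is nonzero.
  Then \<open>a' = 0\<close>, and the equation containing the nonzero coefficient prescribes
  \<open>b' / \<sigma> b'\<close>.
\<close>

lemma intertwines_second_only:
  assumes I: "intertwines k1 k2 k3 k4 m1 m2 m3 m4 0 b c d"
    and I': "intertwines k1 k2 k3 k4 m1 m2 m3 m4 a' b' c' d'"
    and nz: "b \<noteq> 0" "b' \<noteq> 0"
  shows "proportional 0 b a' b' \<or>
    (\<exists>t. common_multiplier t 0 b c d a' b' c' d' \<and> \<sigma> t = t)"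
proof -
  have k: "k3 = 0" "m4 = 0" "m3 = k1" "m2 = k4"
    and k2: "k2 * \<sigma> b + k4 * b = 0" and m1: "m1 * b + k1 * \<sigma> b = \<sigma> k1 * \<sigma> b"
    and cd: "c = k4 * \<sigma> b" "d = k1 * b"
    using I nz by (auto simp: intertwines_def aut_mult)
  show ?thesis
  proof (cases "k4 = 0 \<and> m1 = 0")
    case True
    then have "\<sigma> k1 = k1" using m1 nz by simp
    moreover have "common_multiplier k1 0 b c d a' b' c' d'"
      using True I I' k k2 nz by (auto simp: intertwines_def common_multiplier_def)
    ultimately show ?thesis by blast
  next
    case False
    have a': "a' = 0"
    proof (rule ccontr)
      assume "a' \<noteq> 0"
      then have "k2 = 0" "m1 = 0" using I' k by (auto simp: intertwines_def)
      then show False using False k2 nz by simp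
    qed
    have k2': "k2 * \<sigma> b' + k4 * b' = 0" and m1': "m1 * b' + k1 * \<sigma> b' = \<sigma> k1 * \<sigma> b'"
      using I' k a' by (auto simp: intertwines_def aut_mult)
    have "k4 * (\<sigma> b * b') = k4 * (b * \<sigma> b')" "m1 * (\<sigma> b * b') = m1 * (b * \<sigma> b')"
      using k2 k2' m1 m1' by algebra+
    then have "\<sigma> (b' / b) = b' / b" using False nz by (intro ratio_fixed) auto
    then have "proportional 0 b a' b'"
      unfolding proportional_def using a' nz by (intro exI[of _ "b' / b"]) auto
    then show ?thesis ..
  qed
qed

text \<open>
  The algebra shared by the two rows of \<open>T\<close>: the coefficient \<open>p\<close> is \<open>k2\<close> for the
  first row and \<open>m2\<close> for the second. The linear relations give
  \<open>b' = sb\<close> and \<open>a' = (\<sigma> s) a\<close>. Under this substitution the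
  difference of norms is multiplied by \<open>s (\<sigma> s)\<close> but the square \<open>b\<^sup>2\<close> by \<open>s\<^sup>2\<close>,
  so either \<open>s\<close> is fixed by \<open>\<sigma>\<close> or the norms agree.
\<close>

lemma equal_norms_if_not_proportional:
  assumes nz: "a \<noteq> 0" "b \<noteq> 0" "a' \<noteq> 0" "b' \<noteq> 0" "p \<noteq> 0"
    and "p * \<sigma> a = r * b" "p * \<sigma> a' = r * b'"
    and "q * (b * b) = p * (a * \<sigma> a - b * \<sigma> b)"
    and "q * (b' * b') = p * (a' * \<sigma> a' - b' * \<sigma> b')"
    and np: "\<not> proportional a b a' b'"
  shows "a * \<sigma> a = b * \<sigma> b" "a' * \<sigma> a' = b' * \<sigma> b'" "\<sigma> a * b' = \<sigma> a' * b"
    "\<sigma> (b' / b) \<noteq> b' / b"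
proof -
  define s where "s = b' / b"
  have b': "b' = s * b" and s: "s \<noteq> 0" using nz by (auto simp: s_def)
  have "p * (\<sigma> a * b') = p * (\<sigma> a' * b)" using assms(6,7) by algebra
  then show r: "\<sigma> a * b' = \<sigma> a' * b" using nz by simp
  then have "\<sigma> a' = s * \<sigma> a" using nz by (simp add: s_def field_simps)
  then have a': "a' = \<sigma> s * a" by (metis aut_mult conj_conj)
  show ne: "\<sigma> (b' / b) \<noteq> b' / b"
    using np a' b' s unfolding proportional_def s_def[symmetric] by metis
  have "p * (s * (\<sigma> s - s) * (a * \<sigma> a - b * \<sigma> b)) = 0"
    using assms(8,9) unfolding a' b' aut_mult conj_conj by algebra
  then show n: "a * \<sigma> a = b * \<sigma> b" using nz s ne by (simp add: s_def)
  show "a' * \<sigma> a' = b' * \<sigma> b'" 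
    using n unfolding a' b' aut_mult conj_conj by algebra
qed

text \<open>
  A nonzero \<open>k2\<close> would force equal norms by the previous lemma, and then comparing the
  two systems gives \<open>m4 = 0\<close> and \<open>k3 = 0\<close>, hence \<open>k2 = 0\<close> after all. So the first row
  is \<open>(k1, 0)\<close>. In the second row \<open>m2 = 0\<close> makes \<open>T\<close> multiplication by \<open>k1\<close>
  in \<open>F\<close>, while \<open>m2 \<noteq> 0\<close> forces equal norms, now without a contradiction.
\<close>

lemma intertwines_full_support:
  assumes I: "intertwines k1 k2 k3 k4 m1 m2 m3 m4 a b c d"
    and I': "intertwines k1 k2 k3 k4 m1 m2 m3 m4 a' b' c' d'"
    and nz: "a \<noteq> 0" "b \<noteq> 0" "a' \<noteq> 0" "b' \<noteq> 0"
    and np: "\<not> proportional a b a' b'"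
  shows "\<exists>t. common_multiplier t a b c d a' b' c' d' \<and>
    (\<sigma> t = t \<or> a * \<sigma> a = b * \<sigma> b \<and> a' * \<sigma> a' = b' * \<sigma> b' \<and> \<sigma> a * b' = \<sigma> a' * b)"
proof -
  note eqs = intertwinesD[OF I] and eqs' = intertwinesD[OF I']
  have k2: "k2 = 0"
  proof (rule ccontr)
    assume "k2 \<noteq> 0"
    have p: "k2 * \<sigma> a = (- k3) * b" using eqs(2) by algebra
    have p': "k2 * \<sigma> a' = (- k3) * b'" using eqs'(2) by algebra
    have q: "k4 * (b * b) = k2 * (a * \<sigma> a - b * \<sigma> b)"
      using eqs(2,3) by algebra
    have q': "k4 * (b' * b') = k2 * (a' * \<sigma> a' - b' * \<sigma> b')"
      using eqs'(2,3) by algebra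
    note N = equal_norms_if_not_proportional[OF nz \<open>k2 \<noteq> 0\<close> p p' q q' np]
    define s where "s = b' / b"
    have b': "b' = s * b" and s: "s \<noteq> 0" using nz by (auto simp: s_def)
    have "\<sigma> a' = s * \<sigma> a" using N(3) nz by (simp add: s_def field_simps)
    then have a': "a' = \<sigma> s * a" by (metis aut_mult conj_conj)
    \<comment> \<open>\<open>D\<close> and \<open>D'\<close> equate the two expressions for \<open>c\<close> and for \<open>c'\<close>, \<open>E\<close> those for \<open>d\<close>;
      passing from \<open>D\<close> to \<open>D'\<close> multiplies its left side by \<open>\<sigma> s\<close> and its right side by \<open>s\<close>.\<close>
    have D: "(k1 - m3) * a + (k4 - m2) * \<sigma> b = m4 * b"
      using trans[OF eqs(1) eqs(7)[symmetric]] by algebra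
    have D': "(k1 - m3) * a' + (k4 - m2) * \<sigma> b' = m4 * b'"
      using trans[OF eqs'(1) eqs'(7)[symmetric]] by algebra
    have E: "(k1 - m3) * b + (k4 - m2) * \<sigma> a + k3 * \<sigma> b = 0"
      using trans[OF eqs(4) eqs(6)[symmetric]] by algebra
    have "m4 * (b * (\<sigma> s - s)) = 0" using D D' unfolding a' b' aut_mult by algebra
    then have "m4 = 0" using nz N(4) by (simp add: s_def)
    then have "k3 * (\<sigma> b * \<sigma> b) * b = 0"
      using D E N(1) by algebra
    then have "k3 = 0" using nz by simp
    then show False using eqs nz \<open>k2 \<noteq> 0\<close> by simp
  qed
  then have k3: "k3 = 0" using eqs nz by simp
  then have k4: "k4 = 0" using eqs nz k2 by simp
  have cm: "common_multiplier k1 a b c d a' b' c' d'"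
    using eqs eqs' k3 k4 by (simp add: common_multiplier_def)
  show ?thesis
  proof (cases "m2 = 0")
    case True
    then have m3: "m3 = k1" using eqs k3 k4 nz by auto
    then have "m4 = 0" using True eqs k3 k4 nz by auto
    then have "m1 = 0" using eqs nz by simp
    then have "\<sigma> k1 = k1" using eqs m3 k3 k4 \<open>m4 = 0\<close> nz by (auto simp: aut_mult)
    then show ?thesis using cm by blast
  next
    case False
    have p: "m2 * \<sigma> a = (k1 - m3) * b" using trans[OF eqs(4) eqs(6)[symmetric]] k3 k4 by algebra
    have p': "m2 * \<sigma> a' = (k1 - m3) * b'" using trans[OF eqs'(4) eqs'(6)[symmetric]] k3 k4 by algebra
    have "m4 * b = (k1 - m3) * a - m2 * \<sigma> b" using trans[OF eqs(1) eqs(7)[symmetric]] k4 by algebra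
    then have q: "m4 * (b * b) = m2 * (a * \<sigma> a - b * \<sigma> b)" using p by algebra
    have "m4 * b' = (k1 - m3) * a' - m2 * \<sigma> b'" using trans[OF eqs'(1) eqs'(7)[symmetric]] k4 by algebra
    then have q': "m4 * (b' * b') = m2 * (a' * \<sigma> a' - b' * \<sigma> b')" using p' by algebra
    note N = equal_norms_if_not_proportional[OF nz False p p' q q' np]
    show ?thesis using cm N(1-3) by blast
  qed
qed

text \<open>
  Reduction to the three preceding cases. The two systems have the same form, so
  a vanishing coordinate of \<open>x'\<close> is treated by exchanging the two pairs.
\<close>

lemma intertwines_classification:
  assumes I: "intertwines k1 k2 k3 k4 m1 m2 m3 m4 a b c d"
    and I': "intertwines k1 k2 k3 k4 m1 m2 m3 m4 a' b' c' d'"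
    and nz: "a \<noteq> 0 \<or> b \<noteq> 0" "a' \<noteq> 0 \<or> b' \<noteq> 0"
    and np: "\<not> proportional a b a' b'"
  shows "\<exists>t. common_multiplier t a b c d a' b' c' d' \<and>
    (\<sigma> t = t \<or> b = 0 \<and> b' = 0 \<or>
     b \<noteq> 0 \<and> b' \<noteq> 0 \<and> a * \<sigma> a = b * \<sigma> b \<and> a' * \<sigma> a' = b' * \<sigma> b' \<and> \<sigma> a * b' = \<sigma> a' * b)"
proof -
  have np': "\<not> proportional a' b' a b" using np proportional_sym by blast
  have swap: "common_multiplier t a b c d a' b' c' d'"
    if "common_multiplier t a' b' c' d' a b c d" for t
    using that by (auto simp: common_multiplier_def)
  consider "b = 0" | "b' = 0" | "b \<noteq> 0" "b' \<noteq> 0" "a = 0" | "b \<noteq> 0" "b' \<noteq> 0" "a' = 0"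
    | "a \<noteq> 0" "b \<noteq> 0" "a' \<noteq> 0" "b' \<noteq> 0" by blast
  then show ?thesis
  proof cases
    case 1
    then show ?thesis using intertwines_first_only[of k1 k2 k3 k4 m1 m2 m3 m4 a c d a' b' c' d'] I I' nz np
      by blast
  next
    case 2
    then show ?thesis using intertwines_first_only[of k1 k2 k3 k4 m1 m2 m3 m4 a' c' d' a b c d] I I' nz np' swap
      by blast
  next
    case 3
    then show ?thesis using intertwines_second_only[of k1 k2 k3 k4 m1 m2 m3 m4 b c d a' b' c' d'] I I' np
      by blast
  next
    case 4
    then show ?thesis using intertwines_second_only[of k1 k2 k3 k4 m1 m2 m3 m4 b' c' d' a b c d] I I' np' swap
      by blast
  next
    case 5
    then show ?thesis using intertwines_full_support[OF I I'] np by blast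
  qed
qed

section \<open>Operators realizing the four relations\<close>

lemma orbit_eq_by_operator:
  assumes "invertible_on_A emb (right_mult \<sigma> x)" "invertible_on_A emb (right_mult \<sigma> x')"
    and "\<And>u. T (multA \<sigma> u x) = multA \<sigma> u y" "\<And>u. T (multA \<sigma> u x') = multA \<sigma> u y'"
  shows "orbitA \<sigma> x y = orbitA \<sigma> x' y'"
  using orbit_eq_graph[of x T y] orbit_eq_graph[of x' T y'] assms by simp

lemma multA_scaleA_right: "multA \<sigma> u (scaleA emb k z) = scaleA emb k (multA \<sigma> u z)"
  by (cases u; cases z) (simp add: scaleA_def aut_mult aut_fixes algebra_simps)

lemma scaleA_inverse: "k \<noteq> 0 \<Longrightarrow> scaleA emb (inverse k) (scaleA emb k z) = z"
  by (cases z) (simp add: scaleA_def mult.assoc[symmetric] emb_mult[symmetric] emb_one)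

lemma orbit_eq_common_factor:
  assumes inv: "invertible_on_A emb (right_mult \<sigma> x)"
      "invertible_on_A emb (right_mult \<sigma> (scaleA emb k x))"
  shows "orbitA \<sigma> x y = orbitA \<sigma> (scaleA emb k x) (scaleA emb k y)"
proof -
  obtain T where T: "Vector_Spaces.linear (scaleA emb) (scaleA emb) T"
    "\<And>u. T (multA \<sigma> u x) = multA \<sigma> u y"
    using orbit_operator[OF inv(1) refl, of y] by metis
  show ?thesis
    by (rule orbit_eq_by_operator[OF inv, of T])
      (use T in \<open>auto simp: multA_scaleA_right linear_iff_A simp del: split_paired_All split_paired_all\<close>)
qed

lemma orbit_eq_scalar:
  assumes inv: "invertible_on_A emb (right_mult \<sigma> (scaleA emb k y))"
      "invertible_on_A emb (right_mult \<sigma> (scaleA emb k y'))"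
    and "k \<noteq> 0"
  shows "orbitA \<sigma> (scaleA emb k y) y = orbitA \<sigma> (scaleA emb k y') y'"
  by (rule orbit_eq_by_operator[OF inv, of "scaleA emb (inverse k)"])
    (simp_all add: multA_scaleA_right scaleA_inverse \<open>k \<noteq> 0\<close>)

lemma orbit_eq_in_E:
  assumes inv: "invertible_on_A emb (right_mult \<sigma> (a, 0))"
      "invertible_on_A emb (right_mult \<sigma> (t * a, 0))"
  shows "orbitA \<sigma> (a, 0) (c, 0) = orbitA \<sigma> (t * a, 0) (t * c, 0)"
proof (rule orbit_eq_by_operator[OF inv, of "\<lambda>(u, v). (c / a * u, c / a * v)"])
  have a: "a \<noteq> 0" using invertible_nonzero[OF inv(1)] by simp
  fix u
  show "(\<lambda>(u, v). (c / a * u, c / a * v)) (multA \<sigma> u (a, 0)) = multA \<sigma> u (c, 0)"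
    using a by (cases u) simp
  show "(\<lambda>(u, v). (c / a * u, c / a * v)) (multA \<sigma> u (t * a, 0)) = multA \<sigma> u (t * c, 0)"
    using a by (cases u) simp
qed

text \<open>
  If \<open>(z, w) = u (a, b)\<close> with \<open>u = (p, q)\<close>, the relations for \<open>a\<close> and \<open>b\<close> give
  \<open>w - \<sigma> z / l = l a (\<sigma> q)\<close>. Thus \<open>z\<close> and \<open>w - \<sigma> z / l\<close> play the part of new
  coordinates. Replacing \<open>(a, b)\<close> by \<open>(ta, tb)\<close>, and hence \<open>l\<close> by \<open>m\<close>, multiplies
  them by \<open>t\<close> and \<open>mt / l\<close>. This describes \<open>T\<close> through \<open>l\<close>, \<open>m\<close>, \<open>t\<close> alone.
\<close>

lemma orbit_eq_conjugate:
  assumes inv: "invertible_on_A emb (right_mult \<sigma> (a, b))"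
      "invertible_on_A emb (right_mult \<sigma> (a', b'))"
    and nz: "l \<noteq> 0" "m \<noteq> 0"
    and x: "\<sigma> a = l * b" "\<sigma> b = l * a" and x': "\<sigma> a' = l * b'" "\<sigma> b' = l * a'"
    and lm: "l * \<sigma> t = m * t"
  shows "orbitA \<sigma> (a, b) (t * a, t * b) = orbitA \<sigma> (a', b') (t * a', t * b')"
proof -
  define T where "T = (\<lambda>(z, w). (t * z, \<sigma> t / m * \<sigma> z + m * t / l * (w - \<sigma> z / l)))"
  have T: "T (multA \<sigma> u (a, b)) = multA \<sigma> u (t * a, t * b)"
    if x: "\<sigma> a = l * b" "\<sigma> b = l * a" for a b u
  proof -
    obtain p q where u: "u = (p, q)" by (cases u)
    have st: "\<sigma> t = m * t / l" using lm nz by (simp add: field_simps)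
    show ?thesis
      unfolding u T_def using nz
      by (simp add: x st aut_add aut_mult field_simps)
  qed
  show ?thesis by (rule orbit_eq_by_operator[OF inv, of T]) (use T x x' in auto)
qed

lemma conjugate_parameters:
  assumes "a \<noteq> 0 \<or> b \<noteq> 0"
    and "\<sigma> a = l * b" "\<sigma> b = l * a" "\<sigma> c = m * d" "c = t * a" "d = t * b"
  shows "l * \<sigma> t = m * t"
proof -
  have "b \<noteq> 0" using assms by auto
  moreover have "l * \<sigma> t * b = m * t * b"
    using assms by (simp add: aut_mult algebra_simps)
  ultimately show ?thesis by simp
qed

text \<open>
  With \<open>l = \<sigma> a / b\<close>, equality of norms is the same as \<open>\<sigma> b = la\<close>; the required \<open>m\<close>
  is then dictated by the identity \<open>l (\<sigma> t) = mt\<close>.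
\<close>

lemma conjugate_parameters_exist:
  assumes "b \<noteq> 0" "b' \<noteq> 0" "t \<noteq> 0"
    and n: "a * \<sigma> a = b * \<sigma> b" "a' * \<sigma> a' = b' * \<sigma> b'" "\<sigma> a * b' = \<sigma> a' * b"
  obtains l m where "l \<noteq> 0" "m \<noteq> 0"
    "\<sigma> a = l * b" "\<sigma> b = l * a" "\<sigma> a' = l * b'" "\<sigma> b' = l * a'"
    "\<sigma> (t * a) = m * (t * b)" "\<sigma> (t * b) = m * (t * a)"
    "\<sigma> (t * a') = m * (t * b')" "\<sigma> (t * b') = m * (t * a')"
proof -
  define l where "l = \<sigma> a / b"
  have "a \<noteq> 0" using assms by auto
  then have l: "l \<noteq> 0" "\<sigma> a = l * b" "\<sigma> b = l * a" "\<sigma> a' = l * b'"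
    using assms by (auto simp: l_def field_simps)
  then have l': "\<sigma> b' = l * a'" using n(2) assms(2) by (simp add: algebra_simps)
  show thesis
    by (rule that[of l "l * \<sigma> t / t"]) (use l l' assms in \<open>auto simp: aut_mult\<close>)
qed

end

theorem theorem2p1:
  fixes emb :: "'f::field \<Rightarrow> 'e::field"
    and \<sigma> :: "'e \<Rightarrow> 'e"
    and x y x' y' :: "'e \<times> 'e"
    and a b c d a' b' c' d' :: 'e
  assumes "quadratic_extension emb"
    and "extension_automorphism emb \<sigma>"
    and "\<sigma> \<noteq> id"
    and "invertible_on_A emb (right_mult \<sigma> x)"
    and "invertible_on_A emb (right_mult \<sigma> y)"
    and "invertible_on_A emb (right_mult \<sigma> x')"
    and "invertible_on_A emb (right_mult \<sigma> y')"
    and "x = (a, b)" and "y = (c, d)" and "x' = (a', b')" and "y' = (c', d')"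
  shows "(orbitA \<sigma> x y = orbitA \<sigma> x' y' \<longleftrightarrow>
      (\<exists>t. t \<noteq> 0 \<and> x' = scaleA emb t x \<and> y' = scaleA emb t y) \<or>
      (\<exists>m. m \<noteq> 0 \<and> x = scaleA emb m y \<and> x' = scaleA emb m y') \<or>
      (b = 0 \<and> d = 0 \<and> b' = 0 \<and> d' = 0 \<and> (\<exists>t. t \<noteq> 0 \<and> a' = t * a \<and> c' = t * c)) \<or>
      (\<exists>l m t. l \<noteq> 0 \<and> m \<noteq> 0 \<and> t \<noteq> 0 \<and>
        \<sigma> a = l * b \<and> \<sigma> b = l * a \<and> \<sigma> a' = l * b' \<and> \<sigma> b' = l * a' \<and>
        \<sigma> c = m * d \<and> \<sigma> d = m * c \<and> \<sigma> c' = m * d' \<and> \<sigma> d' = m * c' \<and>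
        c = t * a \<and> d = t * b \<and> c' = t * a' \<and> d' = t * b'))
    \<and> (\<forall>l m t. l \<noteq> 0 \<and> m \<noteq> 0 \<and> t \<noteq> 0 \<and>
        \<sigma> a = l * b \<and> \<sigma> b = l * a \<and> \<sigma> a' = l * b' \<and> \<sigma> b' = l * a' \<and>
        \<sigma> c = m * d \<and> \<sigma> d = m * c \<and> \<sigma> c' = m * d' \<and> \<sigma> d' = m * c' \<and>
        c = t * a \<and> d = t * b \<and> c' = t * a' \<and> d' = t * b'
        \<longrightarrow> l * \<sigma> t = m * t)"
proof -
  interpret quadratic_extension emb by fact
  interpret extension_automorphism emb \<sigma> by fact
  interpret conjugation_extension emb \<sigma> by unfold_locales fact
  note coords = \<open>x = (a, b)\<close> \<open>y = (c, d)\<close> \<open>x' = (a', b')\<close> \<open>y' = (c', d')\<close>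
  note inv = assms(4-7)
  note inv_coords = inv[unfolded coords]
  note nz = inv_coords[THEN invertible_nonzero]
  let ?i = "\<exists>t. t \<noteq> 0 \<and> x' = scaleA emb t x \<and> y' = scaleA emb t y"
  let ?ii = "\<exists>m. m \<noteq> 0 \<and> x = scaleA emb m y \<and> x' = scaleA emb m y'"
  let ?iii = "b = 0 \<and> d = 0 \<and> b' = 0 \<and> d' = 0 \<and> (\<exists>t. t \<noteq> 0 \<and> a' = t * a \<and> c' = t * c)"
  let ?P = "\<lambda>l m t. l \<noteq> 0 \<and> m \<noteq> 0 \<and> t \<noteq> 0 \<and>
        \<sigma> a = l * b \<and> \<sigma> b = l * a \<and> \<sigma> a' = l * b' \<and> \<sigma> b' = l * a' \<and>
        \<sigma> c = m * d \<and> \<sigma> d = m * c \<and> \<sigma> c' = m * d' \<and> \<sigma> d' = m * c' \<and>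
        c = t * a \<and> d = t * b \<and> c' = t * a' \<and> d' = t * b'"
  have params: "l * \<sigma> t = m * t" if "?P l m t" for l m t
    using conjugate_parameters[OF nz(1), of l c m d t] that by blast
  have "?i \<or> ?ii \<or> ?iii \<or> (\<exists>l m t. ?P l m t)" if orbits: "orbitA \<sigma> x y = orbitA \<sigma> x' y'"
  proof -
    obtain T where lin: "Vector_Spaces.linear (scaleA emb) (scaleA emb) T"
      and T: "\<And>u. T (multA \<sigma> u x) = multA \<sigma> u y" "\<And>u. T (multA \<sigma> u x') = multA \<sigma> u y'"
      by (rule orbit_operator[OF inv(1) orbits], rule that)
    obtain k1 k2 k3 k4 m1 m2 m3 m4 where
      "\<And>u v. T (u, v) = (k1 * u + k2 * \<sigma> u + k3 * v + k4 * \<sigma> v,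
                    m1 * u + m2 * \<sigma> u + m3 * v + m4 * \<sigma> v)"
      by (rule linear_map_A[OF lin], rule that)
    note I = intertwines_if_operator[OF this T(1)[unfolded coords]]
      and I' = intertwines_if_operator[OF this T(2)[unfolded coords]]
    show ?thesis
    proof (cases "proportional a b a' b'")
      case True
      then obtain s where s: "\<sigma> s = s" "s \<noteq> 0" "a' = s * a" "b' = s * b"
        by (auto simp: proportional_def)
      obtain k where k: "s = emb k" using fixed_by_conj[OF s(1)] .
      have "c' = s * c \<and> d' = s * d" by (rule intertwines_proportional[OF I I' s(1,3,4)])
      then have ?i using s k by (intro exI[of _ k]) (auto simp: coords scaleA_def)
      then show ?thesis ..
    next
      case False
      obtain t where t: "c = t * a" "d = t * b" "c' = t * a'" "d' = t * b'"
        and alt: "\<sigma> t = t \<or> b = 0 \<and> b' = 0 \<or> b \<noteq> 0 \<and> b' \<noteq> 0 \<and>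
          a * \<sigma> a = b * \<sigma> b \<and> a' * \<sigma> a' = b' * \<sigma> b' \<and> \<sigma> a * b' = \<sigma> a' * b"
        using intertwines_classification[OF I I' nz(1,3) False]
        unfolding common_multiplier_def by metis
      have "t \<noteq> 0" using t nz(2) by auto
      from alt show ?thesis
      proof (elim disjE conjE)
        assume "\<sigma> t = t"
        then obtain k where k: "t = emb k" using fixed_by_conj by metis
        then have "k \<noteq> 0" using \<open>t \<noteq> 0\<close> by auto
        then have "x = scaleA emb (inverse k) y" "x' = scaleA emb (inverse k) y'"
          using scaleA_inverse[of k x] scaleA_inverse[of k x'] t k
          by (auto simp: coords scaleA_def)
        then have ?ii using \<open>k \<noteq> 0\<close> by (intro exI[of _ "inverse k"]) auto
        then show ?thesis by blast
      next
        assume b: "b = 0" "b' = 0"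
        then have ?iii using t nz by (auto intro!: exI[of _ "a' / a"])
        then show ?thesis by blast
      next
        assume "b \<noteq> 0" "b' \<noteq> 0"
          and "a * \<sigma> a = b * \<sigma> b" "a' * \<sigma> a' = b' * \<sigma> b'" "\<sigma> a * b' = \<sigma> a' * b"
        from conjugate_parameters_exist[OF this(1,2) \<open>t \<noteq> 0\<close> this(3-5)]
        obtain l m where "?P l m t" using t \<open>t \<noteq> 0\<close> by metis
        then show ?thesis by blast
      qed
    qed
  qed
  moreover have "orbitA \<sigma> x y = orbitA \<sigma> x' y'" if ?i
    using that orbit_eq_common_factor inv by blast
  moreover have "orbitA \<sigma> x y = orbitA \<sigma> x' y'" if ?ii
    using that orbit_eq_scalar inv by blast
  moreover have "orbitA \<sigma> x y = orbitA \<sigma> x' y'" if ?iii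
    using that orbit_eq_in_E inv unfolding coords by auto
  moreover have "orbitA \<sigma> x y = orbitA \<sigma> x' y'" if "\<exists>l m t. ?P l m t"
    using that
  proof (elim exE)
    fix l m t assume P: "?P l m t"
    show ?thesis
      using orbit_eq_conjugate[OF inv_coords(1,3), of l m t] params[OF P] P
      unfolding coords by auto
  qed
  ultimately have "orbitA \<sigma> x y = orbitA \<sigma> x' y' \<longleftrightarrow> ?i \<or> ?ii \<or> ?iii \<or> (\<exists>l m t. ?P l m t)"
    by argo
  then show ?thesis by (rule conjI) (intro allI impI, rule params)
qed

end
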